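(* Let $n,m$ be positive integers with $m<n$, and let $f_{3n}=f_n+g_{2n}$ with $f_{3n}\in\mathcal{V}_{3n}^m$, $f_n\in\mathcal{V}_n^m$, $g_{2n}\in\mathcal{W}_n^m$. Let the coefficients $a_{n,k}$, $b_{n,k}$, $a'_k$, $a''_k$ be defined by the expansions $$f_n(x)=\sum_{k=1}^na_{n,k}\Phi_{n,k}^m(x),\qquad g_{2n}(x)=\sum_{k=1}^{2n}b_{n,k}\psi_{n,k}^m(x),$$ $$f_{3n}(x)=\sum_{k=1}^na'_k\,\Phi_{3n}^m(x_k^n,x)+\sum_{k=1}^{2n}a''_k\,\Phi_{3n}^m(y_k^n,x).$$ Then these coefficients are related as follows. Reconstruction formulas: for $k=1,\ldots,n$, $$a'_k=a_{n,k}-\frac{\pi}{n}\sum_{s=1}^{2n}b_{n,s}\sum_{r=0}^{n-1}p_r(x_k^n)\,\Phi_{n,r}^{m,\bot}(y_s^n),$$ and for $k=1,\ldots,2n$, $$a''_k=b_{n,k}+\frac{\pi}{n}\sum_{s=1}^na_{n,s}\sum_{r=0}^{n-1}\Phi_{n,r}^{m,\bot}(y_k^n)\,p_r(x_s^n).$$ Decomposition formulas: for $k=1,\ldots,n$, $$a_{n,k}=\frac{\pi}{3n}\left[\sum_{s=1}^na'_s\sum_{r=0}^{n-1}\frac{p_r(x_k^n)p_r(x_s^n)}{\nu_{n,r}^m}+\sum_{s=1}^{2n}a''_s\sum_{r=0}^{n-1}\frac{p_r(x_k^n)\Phi_{n,r}^{m,\bot}(y_s^n)}{\nu_{n,r}^m}\right],$$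 and for $k=1,\ldots,2n$, $$b_{n,k}=a''_k-\frac{\pi}{3n}\left[\sum_{s=1}^na'_s\sum_{r=0}^{n-1}\frac{\Phi_{n,r}^{m,\bot}(y_k^n)p_r(x_s^n)}{\nu_{n,r}^m}+\sum_{s=1}^{2n}a''_s\sum_{r=0}^{n-1}\frac{\Phi_{n,r}^{m,\bot}(y_k^n)\Phi_{n,r}^{m,\bot}(y_s^n)}{\nu_{n,r}^m}\right].$$
   Context: Let $w(x)=1/\sqrt{1-x^2}$ on $[-1,1]$ and $\langle f,g\rangle_{L^2_w}=\int_{-1}^1f(x)g(x)w(x)\,dx$; orthogonality is with respect to this scalar product. Chebyshev nodes: $X_n=\{x_k^n=\cos\frac{(2k-1)\pi}{2n}:\ k=1,\ldots,n\}$. One has $X_n\subset X_{3n}$, and $Y_{2n}=X_{3n}\setminus X_n=\{y_k^n:\ k=1,\ldots,2n\}$. Orthonormal Chebyshev polynomials: $p_0=\sqrt{1/\pi}$, $p_r(x)=\sqrt{2/\pi}\cos(r\arccos x)$ for $r>0$. For integers $0<m<N$ put $\mu_{N,r}^m=1$ if $0\le r\le N-m$, $\mu_{N,r}^m=\frac{m+N-r}{2m}$ if $N-m<r<N+m$, and $\mu_{N,r}^m=0$ otherwise. Let $\Phi_N^m(x,y)=\frac{\pi}{N}\sum_{r=0}^{N+m-1}\mu_{N,r}^mp_r(x)p_r(y)$. Scaling functions: $\Phi_{N,k}^m(x)=\Phi_N^m(x_k^N,x)$, $k=1,\ldots,N$; they are linearly independent and $\mathcal{V}_N^m=\mathrm{span}\{\Phi_{N,k}^m:\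 k=1,\ldots,N\}$. An orthogonal basis of $\mathcal{V}_n^m$ is $\Phi_{n,r}^{m,\bot}$, $r=0,\ldots,n-1$, where $\Phi_{n,r}^{m,\bot}=p_r$ if $0\le r\le n-m$ and $\Phi_{n,r}^{m,\bot}=\mu_{n,r}^mp_r-\mu_{n,2n-r}^mp_{2n-r}$ if $n-m<r<n$. Put $\nu_{n,r}^m=\langle\Phi_{n,r}^{m,\bot},\Phi_{n,r}^{m,\bot}\rangle_{L^2_w}$, i.e. $\nu_{n,r}^m=1$ if $0\le r\le n-m$ and $\nu_{n,r}^m=\frac{m^2+(n-r)^2}{2m^2}$ if $n-m<r<n$. One has $\mathcal{V}_n^m\subset\mathcal{V}_{3n}^m$, and $\mathcal{W}_n^m$ is the orthogonal complement of $\mathcal{V}_n^m$ in $\mathcal{V}_{3n}^m$ (dimension $2n$). The interpolating wavelets $\psi_{n,k}^m$, $k=1,\ldots,2n$, are the unique basis of $\mathcal{W}_n^m$ with $\psi_{n,k}^m(y_h^n)=\delta_{h,k}$ for $h,k=1,\ldots,2n$; explicitly $\psi_{n,k}^m(x)=\Phi_{3n}^m(y_k^n,x)-\sum_{h=1}^n\Phi_{n,h}^m(y_k^n)\Phi_{3n}^m(x_h^n,x)$. *)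

theory Defs
  imports "HOL-Analysis.Analysis"
begin

text \<open>
  All functions live on the interval \<open>[-1,1]\<close>. They are represented by total functions on the
  reals whose values outside that interval are irrelevant: every equation between functions
  below is required on \<open>[-1,1]\<close> only.
\<close>

definition cheb_weight :: "real \<Rightarrow> real" where
  "cheb_weight x = 1 / sqrt (1 - x\<^sup>2)"

definition cheb_inner :: "(real \<Rightarrow> real) \<Rightarrow> (real \<Rightarrow> real) \<Rightarrow> real" where
  "cheb_inner f g = (LBINT x:{-1..1}. f x * g x * cheb_weight x)"

definition lin_span :: "'i set \<Rightarrow> ('i \<Rightarrow> real \<Rightarrow> real) \<Rightarrow> (real \<Rightarrow> real) set" where
  "lin_span I \<phi> = {f. \<exists>c. \<forall>x\<in>{-1..1}. f x = (\<Sum>i\<in>I. c i * \<phi> i x)}"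

definition lin_indep :: "'i set \<Rightarrow> ('i \<Rightarrow> real \<Rightarrow> real) \<Rightarrow> bool" where
  "lin_indep I \<phi> \<longleftrightarrow>
     (\<forall>c. (\<forall>x\<in>{-1..1}. (\<Sum>i\<in>I. c i * \<phi> i x) = 0) \<longrightarrow> (\<forall>i\<in>I. c i = 0))"

definition is_basis :: "'i set \<Rightarrow> ('i \<Rightarrow> real \<Rightarrow> real) \<Rightarrow> (real \<Rightarrow> real) set \<Rightarrow> bool" where
  "is_basis I \<phi> U \<longleftrightarrow> (\<forall>i\<in>I. \<phi> i \<in> U) \<and> lin_indep I \<phi> \<and> U \<subseteq> lin_span I \<phi>"

definition cheb_node :: "nat \<Rightarrow> nat \<Rightarrow> real" where
  "cheb_node n k = cos ((2 * real k - 1) * pi / (2 * real n))"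

definition cheb_nodes :: "nat \<Rightarrow> real set" where
  "cheb_nodes n = cheb_node n ` {1..n}"

definition cheb_p :: "nat \<Rightarrow> real \<Rightarrow> real" where
  "cheb_p r x = (if r = 0 then sqrt (1 / pi) else sqrt (2 / pi) * cos (real r * arccos x))"

text \<open>The parameters are always meant to satisfy \<open>0 < m < N\<close> (resp.\ \<open>0 < m < n\<close>).\<close>

definition vp_mu :: "nat \<Rightarrow> nat \<Rightarrow> nat \<Rightarrow> real" where
  "vp_mu m N r =
     (if r \<le> N - m then 1
      else if r < N + m then (real m + real N - real r) / (2 * real m)
      else 0)"

definition vp_kernel :: "nat \<Rightarrow> nat \<Rightarrow> real \<Rightarrow> real \<Rightarrow> real" where
  "vp_kernel m N x y = pi / real N * (\<Sum>r<N + m. vp_mu m N r * cheb_p r x * cheb_p r y)"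

definition scaling_fun :: "nat \<Rightarrow> nat \<Rightarrow> nat \<Rightarrow> real \<Rightarrow> real" where
  "scaling_fun m N k x = vp_kernel m N (cheb_node N k) x"

definition V_space :: "nat \<Rightarrow> nat \<Rightarrow> (real \<Rightarrow> real) set" where
  "V_space m N = lin_span {1..N} (scaling_fun m N)"

definition W_space :: "nat \<Rightarrow> nat \<Rightarrow> (real \<Rightarrow> real) set" where
  "W_space m n = {g \<in> V_space m (3 * n). \<forall>f\<in>V_space m n. cheb_inner f g = 0}"

definition ortho_scaling :: "nat \<Rightarrow> nat \<Rightarrow> nat \<Rightarrow> real \<Rightarrow> real" where
  "ortho_scaling m n r x =
     (if r \<le> n - m then cheb_p r x
      else vp_mu m n r * cheb_p r x - vp_mu m n (2 * n - r) * cheb_p (2 * n - r) x)"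

definition vp_nu :: "nat \<Rightarrow> nat \<Rightarrow> nat \<Rightarrow> real" where
  "vp_nu m n r = cheb_inner (ortho_scaling m n r) (ortho_scaling m n r)"

text \<open>The set of additional nodes is enumerated by \<open>y 1, \<dots>, y (2 * n)\<close> in an arbitrary order.\<close>

definition enum_extra_nodes :: "nat \<Rightarrow> (nat \<Rightarrow> real) \<Rightarrow> bool" where
  "enum_extra_nodes n y \<longleftrightarrow> bij_betw y {1..2 * n} (cheb_nodes (3 * n) - cheb_nodes n)"

text \<open>
  For \<open>0 < m < n\<close> exactly one such family exists (up to values outside \<open>[-1,1]\<close>), namely
  \<open>\<psi> k x = vp_kernel m (3 * n) (y k) x
     - (\<Sum>h=1..n. scaling_fun m n h (y k) * vp_kernel m (3 * n) (cheb_node n h) x)\<close>.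
\<close>

definition interpolating_wavelets ::
    "nat \<Rightarrow> nat \<Rightarrow> (nat \<Rightarrow> real) \<Rightarrow> (nat \<Rightarrow> real \<Rightarrow> real) \<Rightarrow> bool" where
  "interpolating_wavelets m n y \<psi> \<longleftrightarrow>
     is_basis {1..2 * n} \<psi> (W_space m n) \<and>
     (\<forall>h\<in>{1..2 * n}. \<forall>k\<in>{1..2 * n}. \<psi> k (y h) = (if h = k then 1 else 0))"

end

theory Submission
  imports Defs
begin

text \<open>
  Since \<open>vp_kernel m N z w\<close> is the Kronecker delta on the nodes of order \<open>N\<close>, the coefficients are
  nodal values: \<open>a' k = f3n (x k)\<close>, \<open>a'' k = f3n (y k)\<close>, \<open>a k = fn (x k)\<close>, \<open>b k = g2n (y k)\<close>.
  On the \<open>n\<close> coarse nodes \<open>ortho_scaling m n r\<close> coincides with \<open>cheb_p r\<close>, and the degrees are low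
  enough for the Gauss quadrature on the \<open>3 * n\<close> fine nodes to compute \<open>\<langle>ortho_scaling m n r, f\<rangle>\<close>
  exactly. For \<open>f = g2n\<close> this vanishes, which determines \<open>g2n (x k)\<close> from the \<open>b s\<close> and gives the
  reconstruction; for \<open>f = f3n\<close> it equals \<open>vp_nu m n r\<close> times the coefficient of \<open>fn\<close> in the
  orthogonal basis, which gives the decomposition.
\<close>

section \<open>Integration against the Chebyshev weight\<close>

lemma cheb_weight_nonneg: "0 \<le> cheb_weight x" if "\<bar>x\<bar> \<le> 1"
  using that by (simp add: cheb_weight_def abs_square_le_1)

lemma isCont_cheb_weight: "isCont cheb_weight x" if "-1 < x" "x < 1"
proof -
  have "1 - x\<^sup>2 > 0"
    using that by (simp add: abs_square_less_1 abs_less_iff)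
  then show ?thesis
    unfolding cheb_weight_def by (intro continuous_intros) auto
qed

lemma has_real_derivative_sin_arccos:
  assumes "-1 < x" "x < 1" "j > 0"
  shows "((\<lambda>x. - sin (real j * arccos x) / real j) has_real_derivative
           cos (real j * arccos x) * cheb_weight x) (at x)"
  using assms
  by (auto intro!: derivative_eq_intros simp: cheb_weight_def field_simps)

lemma has_real_derivative_uminus_arccos:
  assumes "-1 < x" "x < 1"
  shows "((\<lambda>x. - arccos x) has_real_derivative cheb_weight x) (at x)"
  using assms
  by (auto intro!: derivative_eq_intros simp: cheb_weight_def field_simps)

text \<open>The junk value \<open>1 / 0 = 0\<close> makes the weight vanish at the end points.\<close>

lemma indicator_cheb_weight:
  "indicator {-1..1} x *\<^sub>R (f x * cheb_weight x) =
     indicator (einterval (-1) 1) x *\<^sub>R (f x * cheb_weight x)"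
  by (auto simp: indicator_def einterval_def cheb_weight_def one_ereal_def
      intro: order.not_eq_order_implies_strict)

text \<open>Supplies the end-point hypotheses of the fundamental theorem on
  \<open>einterval\<close>. Limits are the right tool there, since \<open>arccos\<close> is not
  differentiable at -1 and 1.\<close>

lemma tendsto_end_points:
  fixes F :: "real \<Rightarrow> real"
  assumes "continuous_on {-1..1} F"
  shows "((F \<circ> real_of_ereal) \<longlongrightarrow> F (-1)) (at_right (-1))"
    and "((F \<circ> real_of_ereal) \<longlongrightarrow> F 1) (at_left 1)"
proof -
  have "(F \<longlongrightarrow> F (-1)) (at_right (-1))" "(F \<longlongrightarrow> F 1) (at_left 1)"
    using continuous_on_Icc_at_rightD[OF assms] continuous_on_Icc_at_leftD[OF assms] by auto
  then show "((F \<circ> real_of_ereal) \<longlongrightarrow> F (-1)) (at_right (-1))"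
    and "((F \<circ> real_of_ereal) \<longlongrightarrow> F 1) (at_left 1)"
    by (auto simp: one_ereal_def ereal_tendsto_simps1)
qed

text \<open>The weight is unbounded, but its antiderivative \<open>- arccos\<close> has finite
  limits at both ends, which gives integrability because the integrand is nonnegative.\<close>

lemma set_integrable_cheb_weight: "set_integrable lborel {-1..1} cheb_weight"
proof -
  have "set_integrable lborel (einterval (-1) 1) cheb_weight"
  proof (rule interval_integral_FTC_nonneg)
    show "AE x in lborel. -1 < ereal x \<longrightarrow> ereal x < 1 \<longrightarrow> 0 \<le> cheb_weight x"
      by (auto simp: one_ereal_def intro!: cheb_weight_nonneg)
    show "(((\<lambda>x. - arccos x) \<circ> real_of_ereal) \<longlongrightarrow> - arccos (-1)) (at_right (-1))"
      "(((\<lambda>x. - arccos x) \<circ> real_of_ereal) \<longlongrightarrow> - arccos 1) (at_left 1)"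
      by (intro tendsto_end_points continuous_on_minus continuous_on_arccos')+
  qed (auto simp: one_ereal_def intro!: isCont_cheb_weight has_real_derivative_uminus_arccos)
  then show ?thesis
    unfolding set_integrable_def using indicator_cheb_weight[of _ "\<lambda>_. 1"]
    by (simp only: mult_1)
qed

lemma set_integrable_continuous_cheb_weight:
  assumes "continuous_on {-1..1} f"
  shows "set_integrable lborel {-1..1} (\<lambda>x. f x * cheb_weight x)"
proof -
  obtain B where B: "\<And>x. x \<in> {-1..1} \<Longrightarrow> \<bar>f x\<bar> \<le> B"
    using compact_imp_bounded[OF compact_continuous_image[OF assms compact_Icc]]
    unfolding bounded_iff by (metis image_eqI real_norm_def)
  have f: "(\<lambda>x. indicator {-1..1} x *\<^sub>R f x) \<in> borel_measurable borel"
    by (intro borel_measurable_continuous_on_indicator assms) auto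
  have w: "integrable lborel (\<lambda>x. indicator {-1..1} x *\<^sub>R cheb_weight x)"
    using set_integrable_cheb_weight by (simp add: set_integrable_def)
  \<comment> \<open>Each factor carries its own indicator, because continuity of \<open>f\<close>,
    and hence measurability, is known on the interval only. The bound \<open>B\<close> then gives
    the majorant \<open>B * cheb_weight\<close>.\<close>
  have "integrable lborel (\<lambda>x. (indicator {-1..1} x *\<^sub>R f x) * (indicator {-1..1} x *\<^sub>R cheb_weight x))"
  proof (rule Bochner_Integration.integrable_bound[OF integrable_mult_right[OF w, of B]])
    show "(\<lambda>x. (indicator {-1..1} x *\<^sub>R f x) * (indicator {-1..1} x *\<^sub>R cheb_weight x))
            \<in> borel_measurable lborel"
      using borel_measurable_times[OF f borel_measurable_integrable[OF w, simplified]] by simp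
    show "AE x in lborel. norm ((indicator {-1..1} x *\<^sub>R f x) * (indicator {-1..1} x *\<^sub>R cheb_weight x))
            \<le> norm (B * (indicator {-1..1} x *\<^sub>R cheb_weight x))"
    proof (intro AE_I2)
      fix x :: real
      show "norm ((indicator {-1..1} x *\<^sub>R f x) * (indicator {-1..1} x *\<^sub>R cheb_weight x))
              \<le> norm (B * (indicator {-1..1} x *\<^sub>R cheb_weight x))"
        using B[of x] by (auto simp: indicator_def abs_mult intro!: mult_right_mono)
    qed
  qed
  moreover have "(indicator {-1..1} x *\<^sub>R f x) * (indicator {-1..1} x *\<^sub>R cheb_weight x)
      = indicator {-1..1} x *\<^sub>R (f x * cheb_weight x)" for x
    by (simp add: indicator_def)
  ultimately show ?thesis
    unfolding set_integrable_def by (simp only:)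
qed

text \<open>For \<open>j > 0\<close> the antiderivative is a multiple of
  \<open>sin (j * arccos x)\<close>, which vanishes at both ends because \<open>arccos\<close> is 0
  or \<open>pi\<close> there; for \<open>j = 0\<close> it is \<open>- arccos\<close>, which grows by
  \<open>pi\<close>.\<close>

lemma LBINT_cos_arccos:
  "(LBINT x:{-1..1}. cos (real j * arccos x) * cheb_weight x) = (if j = 0 then pi else 0)"
proof -
  let ?f = "\<lambda>x. cos (real j * arccos x) * cheb_weight x"
  let ?F = "\<lambda>x. if j = 0 then - arccos x else - sin (real j * arccos x) / real j"
  have F: "(?F has_real_derivative ?f x) (at x)" if "-1 < x" "x < 1" for x
    using has_real_derivative_sin_arccos[OF that, of j] has_real_derivative_uminus_arccos[OF that]
    by (cases "j = 0") auto
  have cont: "continuous_on {-1..1} ?F"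
    by (cases "j = 0") (auto intro!: continuous_intros)
  have int: "set_integrable lborel {-1..1} ?f"
    by (intro set_integrable_continuous_cheb_weight continuous_intros) auto
  have "(LBINT x:{-1..1}. ?f x) = (LBINT x:einterval (-1) 1. ?f x)"
    unfolding set_lebesgue_integral_def
    by (intro Bochner_Integration.integral_cong refl indicator_cheb_weight)
  also have "\<dots> = (LBINT x=-1..1. ?f x)"
    by (simp add: interval_lebesgue_integral_def one_ereal_def)
  also have "\<dots> = ?F 1 - ?F (-1)"
  proof (rule interval_integral_FTC_integrable)
    show "set_integrable lborel (einterval (-1) 1) ?f"
      using int unfolding set_integrable_def
      by (simp only: indicator_cheb_weight[of _ "\<lambda>x. cos (real j * arccos x)"])
    show "((?F \<circ> real_of_ereal) \<longlongrightarrow> ?F (-1)) (at_right (-1))"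
      "((?F \<circ> real_of_ereal) \<longlongrightarrow> ?F 1) (at_left 1)"
      by (intro tendsto_end_points cont)+
  next
    fix x assume "- 1 < ereal x" "ereal x < 1"
    then have x: "-1 < x" "x < 1"
      by (auto simp: one_ereal_def)
    show "(?F has_vector_derivative ?f x) (at x)"
      using F[OF x] by (simp add: has_real_derivative_iff_has_vector_derivative)
    show "isCont ?f x"
      using x by (intro continuous_intros isCont_cheb_weight isCont_arccos)
  qed (simp add: one_ereal_def)
  also have "\<dots> = (if j = 0 then pi else 0)"
    by (simp add: sin_npi)
  finally show ?thesis .
qed

section \<open>Orthonormality of the Chebyshev polynomials\<close>

lemma continuous_on_cheb_p: "continuous_on {-1..1} (cheb_p r)"
  unfolding cheb_p_def by (cases "r = 0") (auto intro!: continuous_intros)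

lemma cheb_inner_commute: "cheb_inner f g = cheb_inner g f"
  by (simp add: cheb_inner_def mult.commute)

lemma cheb_inner_cong:
  assumes "\<And>x. x \<in> {-1..1} \<Longrightarrow> f x = f' x" "\<And>x. x \<in> {-1..1} \<Longrightarrow> g x = g' x"
  shows "cheb_inner f g = cheb_inner f' g'"
  unfolding cheb_inner_def using assms by (intro set_lebesgue_integral_cong) auto

lemma cheb_inner_sum_left:
  assumes "finite I" "\<And>i. i \<in> I \<Longrightarrow> continuous_on {-1..1} (f i)" "continuous_on {-1..1} g"
  shows "cheb_inner (\<lambda>x. \<Sum>i\<in>I. c i * f i x) g = (\<Sum>i\<in>I. c i * cheb_inner (f i) g)"
proof -
  have "set_integrable lborel {-1..1} (\<lambda>x. f i x * g x * cheb_weight x)" if "i \<in> I" for i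
    using that assms by (intro set_integrable_continuous_cheb_weight continuous_intros) auto
  then have int: "integrable lborel (\<lambda>x. indicator {-1..1} x *\<^sub>R (f i x * g x * cheb_weight x))"
    if "i \<in> I" for i
    using that by (simp add: set_integrable_def)
  have "cheb_inner (\<lambda>x. \<Sum>i\<in>I. c i * f i x) g =
      (LBINT x. \<Sum>i\<in>I. c i * (indicator {-1..1} x *\<^sub>R (f i x * g x * cheb_weight x)))"
    unfolding cheb_inner_def set_lebesgue_integral_def
    by (intro Bochner_Integration.integral_cong)
       (auto simp: sum_distrib_left sum_distrib_right mult_ac)
  also have "\<dots> = (\<Sum>i\<in>I. c i * cheb_inner (f i) g)"
    using int by (subst Bochner_Integration.integral_sum)
      (auto simp: cheb_inner_def set_lebesgue_integral_def)
  finally show ?thesis .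
qed

lemma cheb_inner_sum_right:
  assumes "finite I" "\<And>i. i \<in> I \<Longrightarrow> continuous_on {-1..1} (f i)" "continuous_on {-1..1} g"
  shows "cheb_inner g (\<lambda>x. \<Sum>i\<in>I. c i * f i x) = (\<Sum>i\<in>I. c i * cheb_inner g (f i))"
  using cheb_inner_sum_left[OF assms] by (simp add: cheb_inner_commute)

text \<open>Assuming \<open>s \<le> r\<close> makes the natural subtraction exact, so both new
  frequencies fit the evaluations of integrals and nodal sums of single cosines.\<close>

lemma cos_mult_cos_nat:
  assumes "s \<le> r"
  shows "cos (real r * t) * cos (real s * t) =
    (cos (real (r - s) * t) + cos (real (r + s) * t)) / 2"
  using assms by (simp add: cos_times_cos of_nat_diff algebra_simps)

lemma cheb_p_eq: "cheb_p r x = (if r = 0 then sqrt (1 / pi) else sqrt (2 / pi)) * cos (real r * arccos x)"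
  by (simp add: cheb_p_def)

text \<open>Product-to-sum leaves the frequencies \<open>r - s\<close> and \<open>r + s\<close>, and
  only frequency zero has a nonzero integral.\<close>

lemma cheb_inner_cheb_p: "cheb_inner (cheb_p r) (cheb_p s) = (if r = s then 1 else 0)"
proof (induction s r rule: linorder_wlog)
  case (le s r)
  let ?c = "\<lambda>r. if r = 0 then sqrt (1 / pi) else sqrt (2 / pi)"
  have int: "set_integrable lborel {-1..1} (\<lambda>x. cos (real j * arccos x) * cheb_weight x)" for j
    by (intro set_integrable_continuous_cheb_weight continuous_intros) auto
  have "cheb_inner (cheb_p r) (cheb_p s) = (LBINT x:{-1..1}. ?c r * ?c s / 2 *
      (cos (real (r - s) * arccos x) * cheb_weight x + cos (real (r + s) * arccos x) * cheb_weight x))"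
    unfolding cheb_inner_def
  proof (intro set_lebesgue_integral_cong allI impI)
    fix x :: real
    have "cheb_p r x * cheb_p s x = ?c r * ?c s * (cos (real r * arccos x) * cos (real s * arccos x))"
      by (simp only: cheb_p_eq mult_ac)
    also have "\<dots> = ?c r * ?c s / 2 * (cos (real (r - s) * arccos x) + cos (real (r + s) * arccos x))"
      by (simp only: cos_mult_cos_nat[OF le]) simp
    finally show "cheb_p r x * cheb_p s x * cheb_weight x = ?c r * ?c s / 2 *
        (cos (real (r - s) * arccos x) * cheb_weight x + cos (real (r + s) * arccos x) * cheb_weight x)"
      by (simp only: distrib_right mult.assoc)
  qed simp
  also have "\<dots> = ?c r * ?c s / 2 * ((if r - s = 0 then pi else 0) + (if r + s = 0 then pi else 0))"
    by (simp only: set_integral_mult_right set_integral_add[OF int int] LBINT_cos_arccos)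
  \<comment> \<open>The second frequency is zero only for \<open>r = s = 0\<close>; there the
    doubled integral compensates the smaller normalising constant of
    \<open>cheb_p 0\<close>.\<close>
  also have "\<dots> = (if r = s then 1 else 0)"
    using le by auto
  finally show ?case .
next
  case (sym s r)
  then show ?case
    by (simp add: cheb_inner_commute)
qed

section \<open>Chebyshev nodes and their nesting\<close>

lemma cheb_node_in_Icc: "cheb_node N k \<in> {-1..1}"
  by (simp add: cheb_node_def)

lemma arccos_cheb_node:
  assumes "k \<in> {1..N}"
  shows "arccos (cheb_node N k) = (2 * real k - 1) * pi / (2 * real N)"
proof -
  have "(2 * real k - 1) * pi \<le> (2 * real N) * pi"
    using assms by (intro mult_right_mono) auto
  then have "(2 * real k - 1) * pi / (2 * real N) \<le> pi"
    using assms by (simp add: pos_divide_le_eq mult.commute)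
  moreover have "0 \<le> (2 * real k - 1) * pi / (2 * real N)"
    using assms by simp
  ultimately show ?thesis
    unfolding cheb_node_def by (rule arccos_cos[rotated])
qed

lemma inj_on_cheb_node: "inj_on (cheb_node N) {1..N}"
proof (rule inj_onI)
  fix i j assume ij: "i \<in> {1..N}" "j \<in> {1..N}" "cheb_node N i = cheb_node N j"
  then have "(2 * real i - 1) * pi / (2 * real N) = (2 * real j - 1) * pi / (2 * real N)"
    by (metis arccos_cheb_node)
  then show "i = j"
    using ij by (auto simp: field_simps)
qed

text \<open>The index \<open>j = 3 * k - 1\<close> solves
  \<open>2 * j - 1 = 3 * (2 * k - 1)\<close>, so the tripled numerator cancels against the tripled
  denominator.\<close>

lemma cheb_node_3:
  assumes "k \<ge> 1"
  shows "cheb_node (3 * n) (3 * k - 1) = cheb_node n k"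
proof -
  have "(2 * real (3 * k - 1) - 1) * pi / (2 * real (3 * n)) = (3 * ((2 * real k - 1) * pi)) / (3 * (2 * real n))"
    using assms by (simp add: of_nat_diff algebra_simps)
  also have "\<dots> = (2 * real k - 1) * pi / (2 * real n)"
    by (rule mult_divide_mult_cancel_left) simp
  finally show ?thesis
    by (simp only: cheb_node_def)
qed

lemma cheb_nodes_subset: "cheb_nodes n \<subseteq> cheb_nodes (3 * n)"
proof
  fix z assume "z \<in> cheb_nodes n"
  then obtain k where k: "k \<in> {1..n}" "z = cheb_node n k"
    by (auto simp: cheb_nodes_def)
  then have "3 * k - 1 \<in> {1..3 * n}" "z = cheb_node (3 * n) (3 * k - 1)"
    using cheb_node_3[of k n] by auto
  then show "z \<in> cheb_nodes (3 * n)"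
    unfolding cheb_nodes_def by blast
qed

lemma sum_cheb_nodes: "(\<Sum>z\<in>cheb_nodes N. F z) = (\<Sum>k=1..N. F (cheb_node N k))"
  unfolding cheb_nodes_def by (subst sum.reindex[OF inj_on_cheb_node]) simp

section \<open>Discrete orthogonality over the nodes and over the degrees\<close>

lemma cos_sum_odd:
  "2 * sin t * (\<Sum>k=1..N. cos ((2 * real k - 1) * t)) = sin (2 * real N * t)"
proof (induction N)
  case (Suc N)
  have "sin (2 * real (Suc N) * t) - sin (2 * real N * t)
      = 2 * sin t * cos ((2 * real (Suc N) - 1) * t)"
    by (subst sin_diff_sin) (simp add: algebra_simps add_divide_distrib)
  with Suc show ?case
    by (simp add: algebra_simps)
qed simp

lemma sum_cos_cheb_nodes:
  assumes "j < 2 * N"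
  shows "(\<Sum>k=1..N. cos (real j * arccos (cheb_node N k))) = (if j = 0 then real N else 0)"
proof (cases "j = 0")
  case False
  \<comment> \<open>With this \<open>t\<close>, \<open>j\<close> times the \<open>k\<close>-th node
    angle is \<open>(2 * k - 1) * t\<close>. The bound on \<open>j\<close> puts \<open>t\<close>
    strictly between 0 and \<open>pi\<close>, so \<open>sin t\<close> cancels, while
    \<open>sin (2 * N * t) = sin (j * pi) = 0\<close>.\<close>
  let ?t = "real j * pi / (2 * real N)"
  have N: "N > 0"
    using assms by simp
  have "real j * pi < 2 * real N * pi"
    using assms by (intro mult_strict_right_mono) auto
  then have "sin ?t > 0"
    using False N by (intro sin_gt_zero) (auto simp: field_simps)
  moreover have "2 * sin ?t * (\<Sum>k=1..N. cos ((2 * real k - 1) * ?t)) = 0"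
    unfolding cos_sum_odd using N by (simp add: sin_npi)
  moreover have "(\<Sum>k=1..N. cos (real j * arccos (cheb_node N k)))
      = (\<Sum>k=1..N. cos ((2 * real k - 1) * ?t))"
    by (intro sum.cong refl) (simp add: arccos_cheb_node mult_ac)
  ultimately show ?thesis
    using False by simp
qed simp

text \<open>The discrete twin of \<open>cheb_inner_cheb_p\<close>: the bound on \<open>r + s\<close>
  keeps both frequencies below \<open>2 * N\<close>, where the nodal sums of cosines behave like the
  integrals.\<close>

lemma sum_cheb_nodes_cheb_p:
  assumes "r + s < 2 * N"
  shows "pi / real N * (\<Sum>z\<in>cheb_nodes N. cheb_p r z * cheb_p s z) = (if r = s then 1 else 0)"
  using assms
proof (induction s r rule: linorder_wlog)
  case (le s r)
  let ?c = "\<lambda>r. if r = 0 then sqrt (1 / pi) else sqrt (2 / pi)"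
  have "cheb_p r z * cheb_p s z =
      ?c r * ?c s / 2 * (cos (real (r - s) * arccos z) + cos (real (r + s) * arccos z))" for z
  proof -
    have "cheb_p r z * cheb_p s z = ?c r * ?c s * (cos (real r * arccos z) * cos (real s * arccos z))"
      by (simp only: cheb_p_eq mult_ac)
    also have "\<dots> = ?c r * ?c s / 2 * (cos (real (r - s) * arccos z) + cos (real (r + s) * arccos z))"
      by (simp only: cos_mult_cos_nat[OF \<open>s \<le> r\<close>]) simp
    finally show ?thesis .
  qed
  then have "(\<Sum>z\<in>cheb_nodes N. cheb_p r z * cheb_p s z) = ?c r * ?c s / 2 *
      ((if r - s = 0 then real N else 0) + (if r + s = 0 then real N else 0))"
    using le by (simp only: sum_cheb_nodes sum_distrib_left[symmetric] sum.distrib)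
      (subst (1 2) sum_cos_cheb_nodes; force)
  then show ?case
    using le by (cases "r = s"; cases "s = 0") auto
next
  case (sym s r)
  then show ?case
    by (simp add: mult.commute add.commute)
qed

text \<open>The Dirichlet kernel, by telescoping
  \<open>sin ((r + 1/2) * t) - sin ((r - 1/2) * t)\<close>.\<close>

lemma sum_cos_Dirichlet:
  "2 * sin (t / 2) * (\<Sum>r<N. cos (real r * t)) = sin (real N * t - t / 2) + sin (t / 2)"
proof (induction N)
  case (Suc N)
  have "sin (real (Suc N) * t - t / 2) - sin (real N * t - t / 2) = 2 * sin (t / 2) * cos (real N * t)"
    by (subst sin_diff_sin) (simp add: algebra_simps add_divide_distrib)
  with Suc show ?case
    by (simp add: algebra_simps)
qed simp

lemma sum_cos_multiple_pi:
  assumes "0 < l" "l < 2 * N"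
  shows "(\<Sum>r<N. cos (real r * (real l * pi / real N))) = (1 - (-1) ^ l) / 2"
proof -
  let ?t = "real l * pi / real N"
  have "real l * pi < 2 * real N * pi"
    using assms by (intro mult_strict_right_mono) auto
  then have pos: "sin (?t / 2) > 0"
    using assms by (intro sin_gt_zero) (auto simp: field_simps)
  \<comment> \<open>Here \<open>N * t = l * pi\<close>, so the Dirichlet sum depends on the parity
    of \<open>l\<close> only.\<close>
  have "sin (real N * ?t - ?t / 2) = - ((-1) ^ l * sin (?t / 2))"
    using assms by (simp add: sin_diff sin_npi cos_npi)
  then have "2 * sin (?t / 2) * (\<Sum>r<N. cos (real r * ?t)) = 2 * sin (?t / 2) * ((1 - (-1) ^ l) / 2)"
    unfolding sum_cos_Dirichlet by (simp add: algebra_simps)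
  then show ?thesis
    using pos by simp
qed

text \<open>Dual to \<open>sum_cheb_nodes_cheb_p\<close>, with the sum running over degrees instead
  of nodes. It makes the kernel interpolatory.\<close>

lemma sum_cheb_p_nodes:
  assumes "i \<in> {1..N}" "j \<in> {1..N}"
  shows "pi / real N * (\<Sum>r<N. cheb_p r (cheb_node N i) * cheb_p r (cheb_node N j))
    = (if i = j then 1 else 0)"
  using assms
proof (induction j i rule: linorder_wlog)
  case (le j i)
  let ?\<theta> = "\<lambda>k. (2 * real k - 1) * pi / (2 * real N)"
  let ?C = "\<lambda>l. \<Sum>r<N. cos (real r * (real l * pi / real N))"
  have N: "N > 0"
    using le by auto
  have d: "?\<theta> i - ?\<theta> j = real (i - j) * pi / real N" "?\<theta> i + ?\<theta> j = real (i + j - 1) * pi / real N"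
    using le N by (auto simp: of_nat_diff field_simps)
  \<comment> \<open>At \<open>r = 0\<close> the two cosines add up to 2, whereas
    \<open>pi * (cheb_p 0)\<^sup>2\<close> is 1; the last term corrects this.\<close>
  have prod: "pi * (cheb_p r (cheb_node N i) * cheb_p r (cheb_node N j)) =
      cos (real r * (real (i - j) * pi / real N)) + cos (real r * (real (i + j - 1) * pi / real N))
      - (if r = 0 then 1 else 0)" for r
  proof -
    have "cos (real r * ?\<theta> i) * cos (real r * ?\<theta> j) =
      (cos (real r * (?\<theta> i - ?\<theta> j)) + cos (real r * (?\<theta> i + ?\<theta> j))) / 2"
      by (simp only: cos_times_cos right_diff_distrib distrib_left)
    then have "2 * (cos (real r * ?\<theta> i) * cos (real r * ?\<theta> j)) =
      cos (real r * (real (i - j) * pi / real N)) + cos (real r * (real (i + j - 1) * pi / real N))"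
      unfolding d by simp
    moreover have "cheb_p r (cheb_node N i) * cheb_p r (cheb_node N j) =
        (if r = 0 then 1 / pi else 2 / pi) * (cos (real r * ?\<theta> i) * cos (real r * ?\<theta> j))"
    proof -
      have "cheb_p r (cheb_node N i) * cheb_p r (cheb_node N j) =
          (if r = 0 then sqrt (1 / pi) else sqrt (2 / pi))\<^sup>2 * (cos (real r * ?\<theta> i) * cos (real r * ?\<theta> j))"
        using le by (simp only: cheb_p_eq arccos_cheb_node power2_eq_square mult_ac)
      then show ?thesis
        by simp
    qed
    ultimately show ?thesis
      by simp
  qed
  have "pi * (\<Sum>r<N. cheb_p r (cheb_node N i) * cheb_p r (cheb_node N j)) = ?C (i - j) + ?C (i + j - 1) - 1"
    unfolding sum_distrib_left prod using N
    by (simp add: sum.distrib sum_subtractf sum.delta)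
  also have "\<dots> = (if i = j then real N else 0)"
  proof (cases "i = j")
    case True
    moreover have "?C (i + j - 1) = (1 - (-1) ^ (i + j - 1)) / 2"
      using le by (intro sum_cos_multiple_pi) auto
    moreover have "odd (i + j - 1)"
      using le True by auto
    ultimately show ?thesis
      by (simp only: uminus_power_if) simp
  next
    case False
    then have "?C (i - j) = (1 - (-1) ^ (i - j)) / 2" "?C (i + j - 1) = (1 - (-1) ^ (i + j - 1)) / 2"
      using le by (intro sum_cos_multiple_pi; auto)+
    \<comment> \<open>The two frequencies have opposite parity, so one cosine sum is 1 and the other
      0, and the total cancels the correction 1.\<close>
    moreover have "(-1 :: real) ^ (i + j - 1) = - ((-1) ^ (i - j))"
    proof -
      have "i + j - 1 = (i - j) + 2 * (j - 1) + 1"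
        using le by auto
      then show ?thesis
        by (simp only: power_add power_mult) simp
    qed
    ultimately show ?thesis
      using False by (simp add: field_simps)
  qed
  finally show ?case
    using N by (simp add: field_simps)
next
  case (sym j i)
  then show ?case
    by (simp add: mult.commute)
qed

section \<open>Gauss quadrature at the Chebyshev nodes\<close>

lemma cheb_nodes_in_Icc: "z \<in> cheb_nodes N \<Longrightarrow> z \<in> {-1..1}"
  using cheb_node_in_Icc by (auto simp: cheb_nodes_def)

lemma cheb_inner_cheb_p_sums:
  assumes "\<And>x. x \<in> {-1..1} \<Longrightarrow> f x = (\<Sum>i<M. c i * cheb_p i x)"
    and "\<And>x. x \<in> {-1..1} \<Longrightarrow> g x = (\<Sum>j<L. d j * cheb_p j x)"
  shows "cheb_inner f g = (\<Sum>i<M. \<Sum>j<L. c i * d j * (if i = j then 1 else 0))"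
proof -
  have "cheb_inner f g = cheb_inner (\<lambda>x. \<Sum>i<M. c i * cheb_p i x) (\<lambda>x. \<Sum>j<L. d j * cheb_p j x)"
    using assms by (intro cheb_inner_cong)
  also have "\<dots> = (\<Sum>i<M. c i * cheb_inner (cheb_p i) (\<lambda>x. \<Sum>j<L. d j * cheb_p j x))"
    by (intro cheb_inner_sum_left continuous_intros continuous_on_cheb_p) auto
  also have "\<dots> = (\<Sum>i<M. c i * (\<Sum>j<L. d j * cheb_inner (cheb_p i) (cheb_p j)))"
    by (intro sum.cong refl arg_cong2[of _ _ _ _ "(*)"] cheb_inner_sum_right continuous_on_cheb_p) auto
  finally show ?thesis
    by (simp only: cheb_inner_cheb_p sum_distrib_left mult.assoc)
qed

text \<open>All index pairs satisfy \<open>i + j \<le> M + L - 2 < 2 * N\<close>, so continuous and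
  discrete orthogonality turn both sides into the same double sum.\<close>

lemma cheb_gauss_quadrature:
  assumes "f \<in> lin_span {..<M} cheb_p" "g \<in> lin_span {..<L} cheb_p" "M + L \<le> 2 * N + 1"
  shows "cheb_inner f g = pi / real N * (\<Sum>z\<in>cheb_nodes N. f z * g z)"
proof -
  obtain c d where c: "\<And>x. x \<in> {-1..1} \<Longrightarrow> f x = (\<Sum>i<M. c i * cheb_p i x)"
    and d: "\<And>x. x \<in> {-1..1} \<Longrightarrow> g x = (\<Sum>j<L. d j * cheb_p j x)"
    using assms(1,2) unfolding lin_span_def by auto
  have "(\<Sum>z\<in>cheb_nodes N. f z * g z) =
      (\<Sum>z\<in>cheb_nodes N. \<Sum>i<M. \<Sum>j<L. c i * d j * (cheb_p i z * cheb_p j z))"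
  proof (intro sum.cong refl)
    fix z assume "z \<in> cheb_nodes N"
    then have "z \<in> {-1..1}"
      by (rule cheb_nodes_in_Icc)
    then show "f z * g z = (\<Sum>i<M. \<Sum>j<L. c i * d j * (cheb_p i z * cheb_p j z))"
      by (simp only: c d sum_product mult_ac)
  qed
  also have "\<dots> = (\<Sum>i<M. \<Sum>j<L. c i * d j * (\<Sum>z\<in>cheb_nodes N. cheb_p i z * cheb_p j z))"
    by (subst sum.swap) (simp only: sum_distrib_left sum.swap[of _ "{..<L}" "cheb_nodes N"])
  finally have "pi / real N * (\<Sum>z\<in>cheb_nodes N. f z * g z) =
      (\<Sum>i<M. \<Sum>j<L. c i * d j * (pi / real N * (\<Sum>z\<in>cheb_nodes N. cheb_p i z * cheb_p j z)))"
    by (simp add: sum_distrib_left mult_ac)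
  also have "\<dots> = (\<Sum>i<M. \<Sum>j<L. c i * d j * (if i = j then 1 else 0))"
    using assms(3) by (intro sum.cong refl arg_cong2[of _ _ _ _ "(*)"] sum_cheb_nodes_cheb_p) auto
  finally show ?thesis
    using cheb_inner_cheb_p_sums[OF c d] by simp
qed

section \<open>The orthogonal basis, the kernel and the scaling spaces\<close>

text \<open>Aliasing: \<open>p\<^sub>2\<^sub>N\<^sub>-\<^sub>r\<close> and \<open>- p\<^sub>r\<close> agree on the nodes because \<open>cos (N \<theta>)\<close> vanishes there.\<close>

lemma cheb_p_node_reflect:
  assumes "k \<in> {1..N}" "0 < r" "r \<le> N"
  shows "cheb_p (2 * N - r) (cheb_node N k) = - cheb_p r (cheb_node N k)"
proof -
  let ?\<theta> = "(2 * real k - 1) * pi / (2 * real N)"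
  have "real (2 * N - r) * ?\<theta> = real (2 * k - 1) * pi - real r * ?\<theta>"
    using assms by (simp add: of_nat_diff field_simps)
  then have "cos (real (2 * N - r) * ?\<theta>) = cos (real (2 * k - 1) * pi - real r * ?\<theta>)"
    by simp
  also have "\<dots> = - cos (real r * ?\<theta>)"
    using assms by (cases k) (simp_all add: cos_diff cos_npi sin_npi del: of_nat_Suc of_nat_diff)
  finally show ?thesis
    using assms by (simp only: cheb_p_eq arccos_cheb_node) auto
qed

text \<open>For \<open>r \<le> n - m\<close> the index \<open>2 * n - r\<close> is outside the
  summation range, so one coefficient formula covers both cases of the definition.\<close>

lemma ortho_scaling_expansion:
  assumes "0 < m" "m < n" "r < n"
  shows "ortho_scaling m n r x = (\<Sum>i<n + m.
    vp_mu m n i * (if i = r then 1 else if i = 2 * n - r then -1 else 0) * cheb_p i x)"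
proof -
  have "vp_mu m n i * (if i = r then 1 else if i = 2 * n - r then -1 else 0) * cheb_p i x =
      (if i = r then vp_mu m n r * cheb_p r x else 0)
      - (if i = 2 * n - r then vp_mu m n (2 * n - r) * cheb_p (2 * n - r) x else 0)" for i
    using assms by auto
  then have "(\<Sum>i<n + m. vp_mu m n i * (if i = r then 1 else if i = 2 * n - r then -1 else 0) * cheb_p i x)
      = vp_mu m n r * cheb_p r x - (if 2 * n - r < n + m then vp_mu m n (2 * n - r) * cheb_p (2 * n - r) x else 0)"
    using assms by (simp add: sum_subtractf)
  also have "\<dots> = ortho_scaling m n r x"
    using assms by (auto simp: ortho_scaling_def vp_mu_def)
  finally show ?thesis ..
qed

text \<open>
  For \<open>r \<le> n - m\<close> the second summand vanishes, so the two cases of the definition merge.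
\<close>

lemma ortho_scaling_eq:
  assumes "0 < m" "m < n" "r < n"
  shows "ortho_scaling m n r x =
    vp_mu m n r * cheb_p r x - vp_mu m n (2 * n - r) * cheb_p (2 * n - r) x"
  using assms by (auto simp: ortho_scaling_def vp_mu_def)

text \<open>The linear ramp of the filter is point-symmetric about \<open>n\<close>, where its value
  is 1/2.\<close>

lemma vp_mu_reflect:
  assumes "0 < m" "m < n" "r < n"
  shows "vp_mu m n r + vp_mu m n (2 * n - r) = 1"
  using assms by (auto simp: vp_mu_def of_nat_diff field_simps)

text \<open>Aliasing turns \<open>- cheb_p (2 * n - r)\<close> into \<open>cheb_p r\<close>, and the
  two filter weights add up to 1. The case \<open>r = 0\<close> is separate because
  \<open>cheb_p 0\<close> is normalised differently.\<close>

lemma ortho_scaling_node: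
  assumes "0 < m" "m < n" "r < n" "k \<in> {1..n}"
  shows "ortho_scaling m n r (cheb_node n k) = cheb_p r (cheb_node n k)"
proof (cases "r = 0")
  case False
  have "ortho_scaling m n r (cheb_node n k) =
      (vp_mu m n r + vp_mu m n (2 * n - r)) * cheb_p r (cheb_node n k)"
    using assms False by (simp add: ortho_scaling_eq cheb_p_node_reflect distrib_right)
  then show ?thesis
    using assms by (simp add: vp_mu_reflect)
qed (simp add: ortho_scaling_def)

text \<open>With one argument at a node, aliasing folds the degrees above \<open>N\<close> onto
  those below by \<open>r \<mapsto> 2 * N - r\<close>.\<close>

lemma vp_kernel_node:
  assumes "0 < m" "m < N" "k \<in> {1..N}"
  shows "vp_kernel m N (cheb_node N k) x =
    pi / real N * (\<Sum>r<N. cheb_p r (cheb_node N k) * ortho_scaling m N r x)"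
proof -
  let ?F = "\<lambda>r. vp_mu m N r * cheb_p r (cheb_node N k) * cheb_p r x"
  \<comment> \<open>Reflection at \<open>r = N\<close> equates \<open>cheb_p N\<close> with its own
    negative at the node, so the middle degree drops out.\<close>
  have "?F N = 0"
    using cheb_p_node_reflect[of k N N] assms by simp
  \<comment> \<open>Padding with zero filter values makes the range symmetric about
    \<open>N\<close>.\<close>
  have "(\<Sum>r<N + m. ?F r) = (\<Sum>r<2 * N + 1. ?F r)"
    using assms by (intro sum.mono_neutral_left) (auto simp: vp_mu_def)
  also have "{..<2 * N + 1} = {..<N} \<union> insert N {N + 1..2 * N}"
    by auto
  also have "(\<Sum>r\<in>\<dots>. ?F r) = (\<Sum>r<N. ?F r) + (\<Sum>r\<in>{N + 1..2 * N}. ?F r)"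
    using \<open>?F N = 0\<close> by (subst sum.union_disjoint) auto
  also have "(\<Sum>r\<in>{N + 1..2 * N}. ?F r) = (\<Sum>r<N. ?F (2 * N - r))"
    by (rule sum.reindex_bij_witness[of _ "\<lambda>r. 2 * N - r" "\<lambda>r. 2 * N - r"]) auto
  also have "(\<Sum>r<N. ?F r) + (\<Sum>r<N. ?F (2 * N - r)) =
      (\<Sum>r<N. cheb_p r (cheb_node N k) * ortho_scaling m N r x)"
    unfolding sum.distrib[symmetric]
  proof (intro sum.cong refl)
    fix r assume "r \<in> {..<N}"
    then show "?F r + ?F (2 * N - r) = cheb_p r (cheb_node N k) * ortho_scaling m N r x"
      using assms cheb_p_node_reflect[of k N r]
      by (cases "r = 0") (auto simp: ortho_scaling_eq algebra_simps, simp add: vp_mu_def)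
  qed
  finally show ?thesis
    by (simp add: vp_kernel_def)
qed

lemma vp_kernel_nodes:
  assumes "0 < m" "m < N" "z \<in> cheb_nodes N" "w \<in> cheb_nodes N"
  shows "vp_kernel m N z w = (if z = w then 1 else 0)"
proof -
  obtain i j where ij: "i \<in> {1..N}" "z = cheb_node N i" "j \<in> {1..N}" "w = cheb_node N j"
    using assms by (auto simp: cheb_nodes_def)
  have "vp_kernel m N z w = (if i = j then 1 else 0)"
    unfolding ij(2,4) vp_kernel_node[OF assms(1,2) ij(1)] sum_cheb_p_nodes[OF ij(1,3), symmetric]
    using assms ij(3) by (intro arg_cong2[of _ _ _ _ "(*)"] sum.cong) (auto simp: ortho_scaling_node)
  then show ?thesis
    using inj_on_cheb_node[of N] ij by (auto dest: inj_onD)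
qed

lemma V_space_subset_lin_span_cheb_p: "V_space m N \<subseteq> lin_span {..<N + m} cheb_p"
proof
  fix f assume "f \<in> V_space m N"
  then obtain c where c: "\<And>x. x \<in> {-1..1} \<Longrightarrow> f x = (\<Sum>k=1..N. c k * scaling_fun m N k x)"
    by (auto simp: V_space_def lin_span_def)
  let ?d = "\<lambda>r. \<Sum>k=1..N. c k * (pi / real N) * vp_mu m N r * cheb_p r (cheb_node N k)"
  have "f x = (\<Sum>r<N + m. ?d r * cheb_p r x)" if "x \<in> {-1..1}" for x
    unfolding c[OF that] scaling_fun_def vp_kernel_def sum_distrib_left sum_distrib_right
    by (subst sum.swap) (simp add: mult_ac)
  then show "f \<in> lin_span {..<N + m} cheb_p"
    unfolding lin_span_def by (intro CollectI exI[of _ ?d] ballI)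
qed

lemma ortho_scaling_in_lin_span_cheb_p:
  assumes "0 < m" "m < n" "r < n"
  shows "ortho_scaling m n r \<in> lin_span {..<n + m} cheb_p"
  unfolding lin_span_def by (intro CollectI exI ballI) (rule ortho_scaling_expansion[OF assms])

text \<open>Inverts \<open>vp_kernel_node\<close>: weighting the scaling functions with
  \<open>cheb_p r\<close> at the nodes isolates one degree by discrete orthogonality.\<close>

lemma ortho_scaling_in_V_space:
  assumes "0 < m" "m < n" "r < n"
  shows "ortho_scaling m n r \<in> V_space m n"
proof -
  have "ortho_scaling m n r x = (\<Sum>k=1..n. cheb_p r (cheb_node n k) * scaling_fun m n k x)" for x
  proof -
    have "(\<Sum>k=1..n. cheb_p r (cheb_node n k) * scaling_fun m n k x) =
        (\<Sum>k=1..n. \<Sum>s<n. pi / real n * (cheb_p r (cheb_node n k) * cheb_p s (cheb_node n k)) * ortho_scaling m n s x)"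
      using assms by (intro sum.cong refl) (simp add: scaling_fun_def vp_kernel_node sum_distrib_left mult_ac)
    also have "\<dots> = (\<Sum>s<n. pi / real n * (\<Sum>z\<in>cheb_nodes n. cheb_p r z * cheb_p s z) * ortho_scaling m n s x)"
      by (subst sum.swap) (simp add: sum_cheb_nodes sum_distrib_left sum_distrib_right)
    also have "\<dots> = (\<Sum>s<n. (if r = s then 1 else 0) * ortho_scaling m n s x)"
      using assms by (intro sum.cong refl arg_cong2[of _ _ _ _ "(*)"] sum_cheb_nodes_cheb_p) auto
    also have "\<dots> = (\<Sum>s<n. if r = s then ortho_scaling m n s x else 0)"
      by (intro sum.cong) auto
    finally show ?thesis
      using assms by simp
  qed
  then show ?thesis
    unfolding V_space_def lin_span_def by (intro CollectI exI ballI)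
qed

text \<open>The degrees involved, \<open>{r, 2 * n - r}\<close> and \<open>{s, 2 * n - s}\<close>,
  are disjoint when \<open>r\<close> and \<open>s\<close> are distinct and below
  \<open>n\<close>.\<close>

lemma cheb_inner_ortho_scaling:
  assumes "0 < m" "m < n" "r < n" "s < n" "r \<noteq> s"
  shows "cheb_inner (ortho_scaling m n r) (ortho_scaling m n s) = 0"
proof -
  note e = ortho_scaling_expansion[OF assms(1,2)]
  show ?thesis
    unfolding cheb_inner_cheb_p_sums[OF e[OF assms(3)] e[OF assms(4)]]
    using assms by (intro sum.neutral ballI) auto
qed

text \<open>By orthonormality this is a sum of squared coefficients, and the one of degree
  \<open>r\<close> is nonzero. It justifies the divisions in the decomposition.\<close>

lemma vp_nu_pos:
  assumes "0 < m" "m < n" "r < n"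
  shows "vp_nu m n r > 0"
proof -
  let ?c = "\<lambda>i. vp_mu m n i * (if i = r then 1 else if i = 2 * n - r then -1 else 0)"
  have "vp_nu m n r = (\<Sum>i<n + m. \<Sum>j<n + m. ?c i * ?c j * (if i = j then 1 else 0))"
    unfolding vp_nu_def
    by (rule cheb_inner_cheb_p_sums[OF ortho_scaling_expansion[OF assms] ortho_scaling_expansion[OF assms]])
  also have "\<dots> = (\<Sum>i<n + m. ?c i * ?c i)"
  proof (intro sum.cong refl)
    fix i assume "i \<in> {..<n + m}"
    moreover have "(\<Sum>j<n + m. ?c i * ?c j * (if i = j then 1 else 0)) =
        (\<Sum>j<n + m. if i = j then ?c i * ?c j else 0)"
      by (intro sum.cong) auto
    ultimately show "(\<Sum>j<n + m. ?c i * ?c j * (if i = j then 1 else 0)) = ?c i * ?c i"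
      by (simp only: sum.delta' finite_lessThan if_True)
  qed
  also have "\<dots> > 0"
  proof (rule sum_pos2)
    show "0 < ?c r * ?c r"
      using assms by (auto simp: vp_mu_def)
  qed (use assms in auto)
  finally show ?thesis .
qed

lemma sum_cheb_nodes_split:
  assumes "enum_extra_nodes n y"
  shows "(\<Sum>z\<in>cheb_nodes (3 * n). F z) = (\<Sum>k=1..n. F (cheb_node n k)) + (\<Sum>k=1..2*n. F (y k))"
proof -
  have "(\<Sum>z\<in>cheb_nodes (3 * n). F z) =
      (\<Sum>z\<in>cheb_nodes (3 * n) - cheb_nodes n. F z) + (\<Sum>z\<in>cheb_nodes n. F z)"
    by (intro sum.subset_diff cheb_nodes_subset) (simp add: cheb_nodes_def)
  also have "(\<Sum>z\<in>cheb_nodes (3 * n) - cheb_nodes n. F z) = (\<Sum>k=1..2*n. F (y k))"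
    using assms unfolding enum_extra_nodes_def by (rule sum.reindex_bij_betw[symmetric])
  finally show ?thesis
    by (simp only: sum_cheb_nodes add.commute)
qed

theorem theorem5p2:
  fixes n m :: nat
    and y :: "nat \<Rightarrow> real"
    and \<psi> :: "nat \<Rightarrow> real \<Rightarrow> real"
    and f3n fn g2n :: "real \<Rightarrow> real"
    and a b a' a'' :: "nat \<Rightarrow> real"
  assumes "0 < m" and "m < n"
    and "enum_extra_nodes n y"
    and "interpolating_wavelets m n y \<psi>"
    and "f3n \<in> V_space m (3 * n)" and "fn \<in> V_space m n" and "g2n \<in> W_space m n"
    and "\<forall>x\<in>{-1..1}. f3n x = fn x + g2n x"
    and "\<forall>x\<in>{-1..1}. fn x = (\<Sum>k=1..n. a k * scaling_fun m n k x)"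
    and "\<forall>x\<in>{-1..1}. g2n x = (\<Sum>k=1..2*n. b k * \<psi> k x)"
    and "\<forall>x\<in>{-1..1}. f3n x =
           (\<Sum>k=1..n. a' k * vp_kernel m (3 * n) (cheb_node n k) x)
         + (\<Sum>k=1..2*n. a'' k * vp_kernel m (3 * n) (y k) x)"
  shows "(\<forall>k\<in>{1..n}. a' k = a k - pi / real n *
            (\<Sum>s=1..2*n. b s * (\<Sum>r<n. cheb_p r (cheb_node n k) * ortho_scaling m n r (y s))))
       \<and> (\<forall>k\<in>{1..2*n}. a'' k = b k + pi / real n *
            (\<Sum>s=1..n. a s * (\<Sum>r<n. ortho_scaling m n r (y k) * cheb_p r (cheb_node n s))))
       \<and> (\<forall>k\<in>{1..n}. a k = pi / (3 * real n) *
            ((\<Sum>s=1..n. a' s *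
                (\<Sum>r<n. cheb_p r (cheb_node n k) * cheb_p r (cheb_node n s) / vp_nu m n r))
           + (\<Sum>s=1..2*n. a'' s *
                (\<Sum>r<n. cheb_p r (cheb_node n k) * ortho_scaling m n r (y s) / vp_nu m n r))))
       \<and> (\<forall>k\<in>{1..2*n}. b k = a'' k - pi / (3 * real n) *
            ((\<Sum>s=1..n. a' s *
                (\<Sum>r<n. ortho_scaling m n r (y k) * cheb_p r (cheb_node n s) / vp_nu m n r))
           + (\<Sum>s=1..2*n. a'' s *
                (\<Sum>r<n. ortho_scaling m n r (y k) * ortho_scaling m n r (y s) / vp_nu m n r))))"
proof -
  let ?x = "cheb_node n" and ?O = "ortho_scaling m n"
  note m = assms(1,2)
  note f3n_eq = bspec[OF assms(8)] and fn_eq = bspec[OF assms(9)]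
    and g_eq = bspec[OF assms(10)] and f3n_exp = bspec[OF assms(11)]
  have m3: "m < 3 * n" and n: "n > 0"
    using m by auto
  have xI: "?x k \<in> {-1..1}" for k
    by (rule cheb_node_in_Icc)
  have bij: "bij_betw y {1..2 * n} (cheb_nodes (3 * n) - cheb_nodes n)"
    using assms(3) by (simp add: enum_extra_nodes_def)
  have xn: "?x k \<in> cheb_nodes n" if "k \<in> {1..n}" for k
    using that by (auto simp: cheb_nodes_def)
  have x3: "?x k \<in> cheb_nodes (3 * n)" if "k \<in> {1..n}" for k
    using xn[OF that] cheb_nodes_subset by blast
  have y3: "y k \<in> cheb_nodes (3 * n)" "y k \<notin> cheb_nodes n" if "k \<in> {1..2*n}" for k
    using bij_betwE[OF bij] that by auto
  have yI: "y k \<in> {-1..1}" if "k \<in> {1..2*n}" for k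
    using cheb_nodes_in_Icc[OF y3(1)[OF that]] .
  have xy: "?x i \<noteq> y j" "y j \<noteq> ?x i" if "i \<in> {1..n}" "j \<in> {1..2*n}" for i j
    using xn y3(2) that by metis+
  have xinj: "?x i = ?x j \<longleftrightarrow> i = j" if "i \<in> {1..n}" "j \<in> {1..n}" for i j
    using inj_onD[OF inj_on_cheb_node] that by blast
  have yinj: "y i = y j \<longleftrightarrow> i = j" if "i \<in> {1..2*n}" "j \<in> {1..2*n}" for i j
    using inj_onD[OF bij_betw_imp_inj_on[OF bij]] that by blast

  \<comment> \<open>Coefficients as nodal values\<close>
  have f3n_x: "f3n (?x j) = a' j" if j: "j \<in> {1..n}" for j
  proof -
    have "f3n (?x j) = (\<Sum>k=1..n. if k = j then a' k else 0) + (\<Sum>k=1..2*n. 0)"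
      unfolding f3n_exp[OF xI] using j x3 y3 xy xinj m m3
      by (intro arg_cong2[of _ _ _ _ "(+)"] sum.cong refl) (auto simp: vp_kernel_nodes)
    then show ?thesis
      using j by simp
  qed
  have f3n_y: "f3n (y j) = a'' j" if j: "j \<in> {1..2*n}" for j
  proof -
    have "f3n (y j) = (\<Sum>k=1..n. 0) + (\<Sum>k=1..2*n. if k = j then a'' k else 0)"
      unfolding f3n_exp[OF yI[OF j]] using j x3 y3 xy yinj m m3
      by (intro arg_cong2[of _ _ _ _ "(+)"] sum.cong refl) (auto simp: vp_kernel_nodes)
    then show ?thesis
      using j by simp
  qed
  have fn_x: "fn (?x j) = a j" if j: "j \<in> {1..n}" for j
  proof -
    have "fn (?x j) = (\<Sum>k=1..n. if k = j then a k else 0)"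
      unfolding fn_eq[OF xI] scaling_fun_def using j xn xinj m
      by (intro sum.cong refl) (auto simp: vp_kernel_nodes)
    then show ?thesis
      using j by simp
  qed
  have g_y: "g2n (y j) = b j" if j: "j \<in> {1..2*n}" for j
  proof -
    have "g2n (y j) = (\<Sum>k=1..2*n. if k = j then b k else 0)"
      unfolding g_eq[OF yI[OF j]] using j assms(4)
      by (intro sum.cong refl) (auto simp: interpolating_wavelets_def)
    then show ?thesis
      using j by simp
  qed

  \<comment> \<open>Quadrature and the values of \<open>g2n\<close> at the coarse nodes\<close>
  have quad: "cheb_inner (?O r) f = pi / real (3 * n) *
      ((\<Sum>k=1..n. cheb_p r (?x k) * f (?x k)) + (\<Sum>k=1..2*n. ?O r (y k) * f (y k)))"
    if "r < n" "f \<in> V_space m n \<union> V_space m (3 * n)" for r f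
  proof -
    have "\<exists>M. f \<in> lin_span {..<M} cheb_p \<and> M \<le> 3 * n + m"
      using that(2)
    proof
      assume "f \<in> V_space m n"
      then show ?thesis
        using V_space_subset_lin_span_cheb_p[of m n] by (intro exI[of _ "n + m"]) auto
    next
      assume "f \<in> V_space m (3 * n)"
      then show ?thesis
        using V_space_subset_lin_span_cheb_p[of m "3 * n"] by (intro exI[of _ "3 * n + m"]) auto
    qed
    then obtain M where M: "f \<in> lin_span {..<M} cheb_p" "M \<le> 3 * n + m"
      by blast
    \<comment> \<open>Exactness on \<open>3 * n\<close> nodes requires
      \<open>(n + m) + (3 * n + m) \<le> 6 * n + 1\<close>, which follows from
      \<open>m < n\<close>.\<close>
    have "cheb_inner (?O r) f = pi / real (3 * n) * (\<Sum>z\<in>cheb_nodes (3 * n). ?O r z * f z)"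
      using ortho_scaling_in_lin_span_cheb_p[OF m that(1)] M m
      by (intro cheb_gauss_quadrature) auto
    also have "(\<Sum>z\<in>cheb_nodes (3 * n). ?O r z * f z) =
        (\<Sum>k=1..n. cheb_p r (?x k) * f (?x k)) + (\<Sum>k=1..2*n. ?O r (y k) * f (y k))"
      unfolding sum_cheb_nodes_split[OF assms(3)]
      using m that by (simp add: ortho_scaling_node)
    finally show ?thesis .
  qed
  have g_orth: "cheb_inner (?O r) g2n = 0" if "r < n" for r
    using assms(7) ortho_scaling_in_V_space[OF m that] by (simp add: W_space_def)
  have gV: "g2n \<in> V_space m (3 * n)"
    using assms(7) by (simp add: W_space_def)

  have g_moments: "(\<Sum>h=1..n. cheb_p r (?x h) * g2n (?x h)) = - (\<Sum>s=1..2*n. ?O r (y s) * b s)"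
    if "r < n" for r
  proof -
    have "(\<Sum>k=1..n. cheb_p r (?x k) * g2n (?x k)) + (\<Sum>k=1..2*n. ?O r (y k) * g2n (y k)) = 0"
      using quad[OF that, of g2n] gV g_orth[OF that] n by simp
    then show ?thesis
      using g_y by simp
  qed
  have g_x: "g2n (?x k) = - (pi / real n * (\<Sum>s=1..2*n. b s * (\<Sum>r<n. cheb_p r (?x k) * ?O r (y s))))"
    if k: "k \<in> {1..n}" for k
  proof -
    have "g2n (?x k) = (\<Sum>h=1..n. if k = h then g2n (?x h) else 0)"
      using k by simp
    \<comment> \<open>Writing the Kronecker delta as a sum over degrees expresses the nodal value
      through the moments of \<open>g_moments\<close>.\<close>
    also have "\<dots> = (\<Sum>h=1..n. (pi / real n * (\<Sum>r<n. cheb_p r (?x k) * cheb_p r (?x h))) * g2n (?x h))"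
      using k by (intro sum.cong refl, subst sum_cheb_p_nodes) auto
    also have "\<dots> = pi / real n * (\<Sum>r<n. cheb_p r (?x k) * (\<Sum>h=1..n. cheb_p r (?x h) * g2n (?x h)))"
      unfolding sum_distrib_left sum_distrib_right by (subst sum.swap) (simp only: mult_ac)
    also have "\<dots> = pi / real n * (\<Sum>r<n. cheb_p r (?x k) * - (\<Sum>s=1..2*n. ?O r (y s) * b s))"
      using g_moments by simp
    also have "\<dots> = - (pi / real n * (\<Sum>s=1..2*n. b s * (\<Sum>r<n. cheb_p r (?x k) * ?O r (y s))))"
      unfolding sum_distrib_left sum_negf[symmetric] mult_minus_right
      by (subst sum.swap) (simp only: mult_ac)
    finally show ?thesis .
  qed

  \<comment> \<open>Coefficients of \<open>fn\<close> in the orthogonal basis\<close>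
  define c where "c r = pi / real n * (\<Sum>s=1..n. a s * cheb_p r (?x s))" for r
  have fn_ortho: "fn x = (\<Sum>r<n. c r * ?O r x)" if "x \<in> {-1..1}" for x
  proof -
    have "fn x = (\<Sum>s=1..n. a s * (pi / real n * (\<Sum>r<n. cheb_p r (?x s) * ?O r x)))"
      unfolding fn_eq[OF that] scaling_fun_def using m by (simp add: vp_kernel_node)
    also have "\<dots> = (\<Sum>r<n. c r * ?O r x)"
      unfolding c_def sum_distrib_left sum_distrib_right by (subst sum.swap) (simp only: mult_ac)
    finally show ?thesis .
  qed
  have c_eq: "c r = pi / (3 * real n) *
      ((\<Sum>s=1..n. a' s * cheb_p r (?x s)) + (\<Sum>s=1..2*n. a'' s * ?O r (y s))) / vp_nu m n r"
    if r: "r < n" for r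
  proof -
    have cont: "continuous_on {-1..1} (?O s)" for s
      unfolding ortho_scaling_def using continuous_on_cheb_p
      by (cases "s \<le> n - m") (auto intro!: continuous_intros)
    have "cheb_inner (?O r) fn = cheb_inner (?O r) (\<lambda>x. \<Sum>s<n. c s * ?O s x)"
      using fn_ortho by (intro cheb_inner_cong) auto
    also have "\<dots> = (\<Sum>s<n. c s * cheb_inner (?O r) (?O s))"
      by (intro cheb_inner_sum_right cont) auto
    also have "\<dots> = (\<Sum>s<n. if s = r then c r * vp_nu m n r else 0)"
      using m r by (intro sum.cong refl) (auto simp: vp_nu_def cheb_inner_ortho_scaling)
    also have "\<dots> = c r * vp_nu m n r"
      using r by simp
    \<comment> \<open>Adding the zero inner product with \<open>g2n\<close> brings in
      \<open>f3n\<close>. Additivity is then read off the finite quadrature sums.\<close>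
    finally have "c r * vp_nu m n r = cheb_inner (?O r) fn + cheb_inner (?O r) g2n"
      using g_orth[OF r] by simp
    also have "\<dots> = cheb_inner (?O r) f3n"
      using quad[OF r] gV assms(5,6) xI yI f3n_eq
      by (simp add: sum.distrib algebra_simps add_divide_distrib)
    also have "\<dots> = pi / (3 * real n) *
      ((\<Sum>s=1..n. a' s * cheb_p r (?x s)) + (\<Sum>s=1..2*n. a'' s * ?O r (y s)))"
      using quad[OF r, of f3n] assms(5) f3n_x f3n_y by (simp add: mult.commute)
    finally show ?thesis
      using vp_nu_pos[OF m r] by (subst nonzero_eq_divide_eq) simp_all
  qed
  \<comment> \<open>The weight \<open>u\<close> is left free: \<open>cheb_p r (?x k)\<close> gives
    the formula for \<open>a k\<close>, and \<open>?O r (y k)\<close> the one for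
    \<open>b k\<close>.\<close>
  have c_sum: "(\<Sum>r<n. c r * u r) = pi / (3 * real n) *
      ((\<Sum>s=1..n. a' s * (\<Sum>r<n. u r * cheb_p r (?x s) / vp_nu m n r))
     + (\<Sum>s=1..2*n. a'' s * (\<Sum>r<n. u r * ?O r (y s) / vp_nu m n r)))" for u
  proof -
    have "(\<Sum>r<n. c r * u r) = (\<Sum>r<n. pi / (3 * real n) *
      ((\<Sum>s=1..n. a' s * (u r * cheb_p r (?x s) / vp_nu m n r))
     + (\<Sum>s=1..2*n. a'' s * (u r * ?O r (y s) / vp_nu m n r))))"
    proof (intro sum.cong refl)
      fix r assume "r \<in> {..<n}"
      then show "c r * u r = pi / (3 * real n) *
        ((\<Sum>s=1..n. a' s * (u r * cheb_p r (?x s) / vp_nu m n r))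
       + (\<Sum>s=1..2*n. a'' s * (u r * ?O r (y s) / vp_nu m n r)))"
        by (simp add: c_eq distrib_left distrib_right sum_distrib_left sum_distrib_right
            add_divide_distrib sum_divide_distrib mult_ac)
    qed
    also have "\<dots> = pi / (3 * real n) *
      ((\<Sum>s=1..n. a' s * (\<Sum>r<n. u r * cheb_p r (?x s) / vp_nu m n r))
     + (\<Sum>s=1..2*n. a'' s * (\<Sum>r<n. u r * ?O r (y s) / vp_nu m n r)))"
      unfolding sum_distrib_left[symmetric] sum.distrib
      by (simp only: sum_distrib_left sum.swap[of _ "{..<n}"])
    finally show ?thesis .
  qed

  \<comment> \<open>The four formulas, from \<open>f3n = fn + g2n\<close> at the nodes\<close>
  have rec_a: "a' k = a k - pi / real n * (\<Sum>s=1..2*n. b s * (\<Sum>r<n. cheb_p r (?x k) * ?O r (y s)))"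
    if "k \<in> {1..n}" for k
    using f3n_x[OF that] fn_x[OF that] g_x[OF that] f3n_eq[OF xI] by simp
  have rec_b: "a'' k = b k + pi / real n * (\<Sum>s=1..n. a s * (\<Sum>r<n. ?O r (y k) * cheb_p r (?x s)))"
    if k: "k \<in> {1..2*n}" for k
  proof -
    have "fn (y k) = pi / real n * (\<Sum>s=1..n. a s * (\<Sum>r<n. ?O r (y k) * cheb_p r (?x s)))"
      unfolding fn_eq[OF yI[OF k]] scaling_fun_def using m
      by (simp add: vp_kernel_node sum_distrib_left mult_ac)
    then show ?thesis
      using f3n_y[OF k] g_y[OF k] f3n_eq[OF yI[OF k]] by simp
  qed
  have dec_a: "a k = (\<Sum>r<n. c r * cheb_p r (?x k))" if "k \<in> {1..n}" for k
    using fn_x[OF that] fn_ortho[OF xI] that m by (simp add: ortho_scaling_node)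
  have dec_b: "b k = a'' k - (\<Sum>r<n. c r * ?O r (y k))" if "k \<in> {1..2*n}" for k
    using f3n_y[OF that] g_y[OF that] f3n_eq[OF yI[OF that]] fn_ortho[OF yI[OF that]] by simp
  show ?thesis
    using rec_a rec_b dec_a dec_b unfolding c_sum by blast
qed

end
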